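(* Assume the link function $\sigma:\mathbb{R}\to[0,1]$ is continuous. Let $\hat\theta$ be a consistent estimator of $\theta_*$, i.e. $|\hat\theta-\theta_*|\to 0$ in probability. Then the angular predictor $\hat f_{\mathrm{ang}}(\cdot;\hat\theta)$ is well-calibrated as $d,n\to\infty$ with $n/d$ converging to a limit in $(0,\infty)$; that is, for any $p$ contained in the range of $\sigma$, $$\Delta_p^{\mathrm{cal}}\big(\hat f_{\mathrm{ang}}(\cdot;\hat\theta)\big)=p-\mathbb{E}_{x_{\mathrm{new}}}\left[\sigma\left(w_\star^\top x_{\mathrm{new}}\right)\,\middle|\,\hat f_{\mathrm{ang}}\left(\hat w^\top x_{\mathrm{new}};\hat\theta\right)=p\right]\to 0$$ in probability.
   Context: Data: for each $d$ in a sequence of problem instances (with $n=n(d)$), i.i.d. pairs $(x_i,y_i)$, $i=1,\dots,n$, are observed with $x_i\sim N(0,\Sigma)$ in $\mathbb{R}^d$, $\Sigma$ a known covariance matrix, and, conditionally on $x_i$, $y_i\sim\mathrm{Bern}(\sigma(w_\star^\top x_i))$. Here $w_\star\in\mathbb{R}^d$ is deterministic and, without loss of generality, $\|w_\star\|_\Sigma=1$, where $\langle u,v\rangle_\Sigma=u^\top\Sigma v$ and $\|u\|_\Sigma=\sqrt{u^\top\Sigma u}$. Estimator: $\hat w=\arg\min_w \frac1n\sum_{i=1}^n\ell_{y_i}(w^\top x_i)+g(w)$, with $\ell$ a convex loss and $g$ a convex penalty (with $\hat w\neq 0$ so that the angle below is defined). Angle: $\theta_*=\arccos\left(\frac{\langle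 w_\star,\hat w\rangle_\Sigma}{\|\hat w\|_\Sigma\|w_\star\|_\Sigma}\right)$. The estimator $\hat\theta$ is computed from observed data (training and possibly held-out), independent of $x_{\mathrm{new}}$. Angular predictor: for an angle $\theta$ and $u\in\mathbb{R}$, $$\hat f_{\mathrm{ang}}(u;\theta)=\mathbb{E}_Z\left[\sigma\left(\cos(\theta)\cdot\frac{u}{\|\hat w\|_\Sigma}+\sin(\theta)\cdot Z\right)\right],\qquad Z\sim N(0,1).$$ $\mathbb{E}_{x_{\mathrm{new}}}$ denotes expectation over a new point $x_{\mathrm{new}}\sim N(0,\Sigma)$ independent of the observed data, with $\hat w,\hat\theta$ held fixed. For a predictor $\hat f$, the calibration error at level $p$ is $\Delta_p^{\mathrm{cal}}(\hat f)=p-\mathbb{E}_{x_{\mathrm{new}}}[\sigma(w_\star^\top x_{\mathrm{new}})\mid \hat f(x_{\mathrm{new}})=p]$.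
   Formalization: For fixed p it is assumed that, with probability tending to 1, conditioning on predictor = p is defined (limit of shrinking windows) and the standardized score given it is tight; without this the claim fails if θ_* = π/2. For all versions, the mass of levels p with error > ε also tends to 0. *)

theory Defs
  imports "HOL-Probability.Probability"
begin

text \<open>
  The dimension changes along the sequence of problem instances, so a vector of dimension
  \<^term>\<open>d\<close> is a function on \<^term>\<open>{..<d}\<close> (an extensional function
  \<^typ>\<open>nat \<Rightarrow> real\<close>), and a matrix is a function of two indices of which only
  those below \<^term>\<open>d\<close> are used.
\<close>

definition vec_space :: "nat \<Rightarrow> (nat \<Rightarrow> real) measure" where
  "vec_space d = PiM {..<d} (\<lambda>_. borel)"

definition dot :: "nat \<Rightarrow> (nat \<Rightarrow> real) \<Rightarrow> (nat \<Rightarrow> real) \<Rightarrow> real" where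
  "dot d u v = (\<Sum>i<d. u i * v i)"

definition inner_cov :: "nat \<Rightarrow> (nat \<Rightarrow> nat \<Rightarrow> real) \<Rightarrow> (nat \<Rightarrow> real) \<Rightarrow> (nat \<Rightarrow> real) \<Rightarrow> real" where
  "inner_cov d S u v = (\<Sum>i<d. \<Sum>j<d. u i * S i j * v j)"

definition norm_cov :: "nat \<Rightarrow> (nat \<Rightarrow> nat \<Rightarrow> real) \<Rightarrow> (nat \<Rightarrow> real) \<Rightarrow> real" where
  "norm_cov d S u = sqrt (inner_cov d S u u)"

definition covariance_matrix :: "nat \<Rightarrow> (nat \<Rightarrow> nat \<Rightarrow> real) \<Rightarrow> bool" where
  "covariance_matrix d S \<longleftrightarrow>
     (\<forall>i<d. \<forall>j<d. S i j = S j i) \<and> (\<forall>u. inner_cov d S u u \<ge> 0)"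

text \<open>
  The centred Gaussian law with covariance matrix \<^term>\<open>S\<close>: every linear functional
  \<^term>\<open>dot d u\<close> has the law of a standard normal variable scaled by
  \<^term>\<open>norm_cov d S u\<close>. This covers singular \<^term>\<open>S\<close>.
\<close>

definition centered_gaussian ::
    "nat \<Rightarrow> (nat \<Rightarrow> nat \<Rightarrow> real) \<Rightarrow> (nat \<Rightarrow> real) measure \<Rightarrow> bool" where
  "centered_gaussian d S N \<longleftrightarrow>
     prob_space N \<and> sets N = sets (vec_space d) \<and>
     (\<forall>u. distr N borel (dot d u) =
          distr std_normal_distribution borel (\<lambda>z. norm_cov d S u * z))"

definition convex_penalty :: "nat \<Rightarrow> ((nat \<Rightarrow> real) \<Rightarrow> real) \<Rightarrow> bool" where
  "convex_penalty d g \<longleftrightarrow>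
     (\<forall>u\<in>space (vec_space d). \<forall>v\<in>space (vec_space d). \<forall>t\<in>{0..1}.
        g (\<lambda>i\<in>{..<d}. (1 - t) * u i + t * v i) \<le> (1 - t) * g u + t * g v)"

definition empirical_objective ::
    "nat \<Rightarrow> nat \<Rightarrow> (bool \<Rightarrow> real \<Rightarrow> real) \<Rightarrow> ((nat \<Rightarrow> real) \<Rightarrow> real) \<Rightarrow>
     (nat \<Rightarrow> nat \<Rightarrow> real) \<Rightarrow> (nat \<Rightarrow> bool) \<Rightarrow> (nat \<Rightarrow> real) \<Rightarrow> real" where
  "empirical_objective d n loss g xs ys w =
     (\<Sum>i<n. loss (ys i) (dot d w (xs i))) / real n + g w"

definition angle_cov ::
    "nat \<Rightarrow> (nat \<Rightarrow> nat \<Rightarrow> real) \<Rightarrow> (nat \<Rightarrow> real) \<Rightarrow> (nat \<Rightarrow> real) \<Rightarrow> real" where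
  "angle_cov d S w v = arccos (inner_cov d S w v / (norm_cov d S v * norm_cov d S w))"

text \<open>In \<^term>\<open>f_ang \<sigma> s u \<theta>\<close> the argument \<^term>\<open>s\<close> is the norm of the
  estimator, by which the score \<^term>\<open>u\<close> is standardised.\<close>

definition f_ang :: "(real \<Rightarrow> real) \<Rightarrow> real \<Rightarrow> real \<Rightarrow> real \<Rightarrow> real" where
  "f_ang \<sigma> s u \<theta> = (\<integral>z. \<sigma> (cos \<theta> * (u / s) + sin \<theta> * z) \<partial>std_normal_distribution)"

definition angular_predictor ::
    "nat \<Rightarrow> (nat \<Rightarrow> nat \<Rightarrow> real) \<Rightarrow> (real \<Rightarrow> real) \<Rightarrow> (nat \<Rightarrow> real) \<Rightarrow> real \<Rightarrow> (nat \<Rightarrow> real) \<Rightarrow> real" where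
  "angular_predictor d S \<sigma> w \<theta> x = f_ang \<sigma> (norm_cov d S w) (dot d w x) \<theta>"

definition tendsto_0_in_prob :: "(nat \<Rightarrow> 'a measure) \<Rightarrow> (nat \<Rightarrow> 'a \<Rightarrow> real) \<Rightarrow> bool" where
  "tendsto_0_in_prob M X \<longleftrightarrow>
     (\<forall>\<epsilon>>0. (\<lambda>k. measure (M k) {\<omega>\<in>space (M k). \<bar>X k \<omega>\<bar> > \<epsilon>}) \<longlonglongrightarrow> 0)"

text \<open>
  The function \<open>p \<mapsto> E[Y | f = p]\<close> under the law \<^term>\<open>N\<close>. Since the event
  \<open>f = p\<close> is typically null, this function is only determined up to null sets of the
  law of \<^term>\<open>f\<close>; the predicate says that \<^term>\<open>m\<close> is one of its versions.
\<close>

definition cond_exp_version ::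
    "'b measure \<Rightarrow> ('b \<Rightarrow> real) \<Rightarrow> ('b \<Rightarrow> real) \<Rightarrow> (real \<Rightarrow> real) \<Rightarrow> bool" where
  "cond_exp_version N f Y m \<longleftrightarrow>
     m \<in> borel_measurable borel \<and>
     (AE x in N. real_cond_exp N (vimage_algebra (space N) f borel) Y x = m (f x))"

text \<open>
  The value \<open>E[Y | f = p]\<close> at one given level \<^term>\<open>p\<close>, as the limit of the elementary
  conditional expectations given \<open>\<bar>f - p\<bar> \<le> \<delta>\<close> as \<open>\<delta>\<close> decreases to 0.
  If \<open>f = p\<close> has positive probability this is the elementary conditional expectation.
\<close>

definition level_window :: "'b measure \<Rightarrow> ('b \<Rightarrow> real) \<Rightarrow> real \<Rightarrow> real \<Rightarrow> 'b set" where
  "level_window N f p \<delta> = {x\<in>space N. \<bar>f x - p\<bar> \<le> \<delta>}"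

definition window_mean ::
    "'b measure \<Rightarrow> ('b \<Rightarrow> real) \<Rightarrow> ('b \<Rightarrow> real) \<Rightarrow> real \<Rightarrow> real \<Rightarrow> real" where
  "window_mean N f Y p \<delta> =
     set_lebesgue_integral N (level_window N f p \<delta>) Y / measure N (level_window N f p \<delta>)"

definition cond_exp_at ::
    "'b measure \<Rightarrow> ('b \<Rightarrow> real) \<Rightarrow> ('b \<Rightarrow> real) \<Rightarrow> real \<Rightarrow> real" where
  "cond_exp_at N f Y p = Lim (at_right 0) (window_mean N f Y p)"

definition calibration_error_at ::
    "'b measure \<Rightarrow> ('b \<Rightarrow> real) \<Rightarrow> ('b \<Rightarrow> real) \<Rightarrow> real \<Rightarrow> real" where
  "calibration_error_at N f Y p = p - cond_exp_at N f Y p"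

text \<open>
  Conditioning on \<open>f = p\<close> makes sense at the single level \<^term>\<open>p\<close>: the level is in the
  support of the law of \<^term>\<open>f\<close> and the limit defining \<^term>\<open>cond_exp_at N f Y p\<close> exists.
\<close>

definition conditionable_level ::
    "'b measure \<Rightarrow> ('b \<Rightarrow> real) \<Rightarrow> ('b \<Rightarrow> real) \<Rightarrow> real \<Rightarrow> bool" where
  "conditionable_level N f Y p \<longleftrightarrow>
     (\<forall>\<delta>>0. measure N (level_window N f p \<delta>) > 0) \<and>
     (\<exists>c. (window_mean N f Y p \<longlongrightarrow> c) (at_right 0))"

text \<open>Given \<open>f = p\<close>, the variable \<^term>\<open>U\<close> exceeds \<^term>\<open>K\<close> in absolute value with
  conditional probability at most \<^term>\<open>\<eta>\<close>.\<close>

definition cond_tail_le ::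
    "'b measure \<Rightarrow> ('b \<Rightarrow> real) \<Rightarrow> ('b \<Rightarrow> real) \<Rightarrow> real \<Rightarrow> real \<Rightarrow> real \<Rightarrow> bool" where
  "cond_tail_le N f U p K \<eta> \<longleftrightarrow>
     (\<forall>\<^sub>F \<delta> in at_right 0.
        measure N {x\<in>level_window N f p \<delta>. \<bar>U x\<bar> > K} \<le> \<eta> * measure N (level_window N f p \<delta>))"

text \<open>
  The level \<^term>\<open>p\<close> does not degenerate along a sequence of (data-dependent) predictors
  \<^term>\<open>f k \<omega>\<close>: with probability tending to one it can be conditioned on, and the conditional
  law of \<^term>\<open>U k \<omega>\<close> given \<^prop>\<open>f k \<omega> x = p\<close> is tight. A pointwise-in-\<^term>\<open>p\<close>
  statement needs such a condition. For instance, if the true angle is \<open>pi / 2\<close> for every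
  \<open>k\<close> and the estimated one is \<open>pi / 2 - 1 / k\<close>, the estimate is consistent, but for a
  logistic link the predictor takes a value other than \<open>1 / 2\<close> only at scores of order \<open>k\<close>,
  while the conditional mean of the label is \<open>1 / 2\<close> at every score.
\<close>

definition nondegenerate_level ::
    "(nat \<Rightarrow> 'a measure) \<Rightarrow> (nat \<Rightarrow> 'b measure) \<Rightarrow> (nat \<Rightarrow> 'a \<Rightarrow> 'b \<Rightarrow> real) \<Rightarrow>
     (nat \<Rightarrow> 'b \<Rightarrow> real) \<Rightarrow> (nat \<Rightarrow> 'a \<Rightarrow> 'b \<Rightarrow> real) \<Rightarrow> real \<Rightarrow> bool" where
  "nondegenerate_level M N f Y U p \<longleftrightarrow>
     (\<forall>\<eta>>0. \<exists>K. \<forall>\<^sub>F k in sequentially.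
        measure (M k) {\<omega>\<in>space (M k). conditionable_level (N k) (f k \<omega>) (Y k) p \<and>
          cond_tail_le (N k) (f k \<omega>) (U k \<omega>) p K \<eta>} \<ge> 1 - \<eta>)"

end

theory Submission
  imports Defs
begin

text \<open>
  The standardised score \<open>X = \<langle>w_hat, x\<rangle> / \<parallel>w_hat\<parallel>\<close> and the true score
  \<open>V = \<langle>w_star, x\<rangle>\<close> of a new point are jointly Gaussian, and \<open>V - cos \<theta>_star X\<close> is independent
  of \<open>X\<close> with standard deviation \<open>sin \<theta>_star\<close>. Hence \<open>E[\<sigma> V | X]\<close> is exactly the angular
  predictor at the true angle. By uniform continuity the predictor at the estimated angle differs from
  it by little when \<open>\<bar>X\<bar> \<le> K\<close>, so conditioning on the predicted value reproduces that value up to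
  this small error and the conditional probability of \<open>\<bar>X\<bar> > K\<close>.
\<close>

subsection \<open>Independence from characteristic functions\<close>

text \<open>\<open>centered_gaussian\<close> describes a law only through its one-dimensional
  projections. The covariance may be singular and the angle may be 0 or \<pi>, so no joint density
  is at hand. Independence of the score and the residual is therefore extracted from the
  characteristic functions of their linear combinations, which the projections do determine. All
  estimates are uniform in the instance and in the data: the true angle stays in the compact
  interval \<open>{0..pi}\<close>, and the standardised score is exactly standard normal in every
  dimension. One modulus of continuity thus serves every \<open>k\<close> and
  \<open>\<omega>\<close>. Conditioning on a null event shapes the conclusion. An average over
  levels is controlled by the unconditional Gaussian tail of the score. At a single level that tail
  says nothing, because the scores producing the level may all be far out; there the conditional
  tail bound of \<open>nondegenerate_level\<close> takes its place.\<close>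

lemma (in prob_space) weighted_char_unique:
  fixes X :: "'a \<Rightarrow> real" and h :: "'a \<Rightarrow> real"
  assumes X [measurable]: "random_variable borel X"
    and h [measurable]: "random_variable borel h" "\<And>x. 0 \<le> h x" "\<And>x. h x \<le> C"
    and \<kappa>: "\<kappa> > 0"
    and char: "\<And>t. (\<integral>x. h x *\<^sub>R iexp (t * X x) \<partial>M) = \<kappa> *\<^sub>R (\<integral>x. iexp (t * X x) \<partial>M)"
    and A [measurable]: "A \<in> sets borel"
  shows "(\<integral>x. h x * indicator A (X x) \<partial>M) = \<kappa> * prob (X -` A \<inter> space M)"
proof -
  \<comment> \<open>Dividing by \<kappa> makes the weight a probability density, since the
    hypothesis at \<open>t = 0\<close> identifies \<kappa> as the mean of \<open>h\<close>. For
    general \<open>t\<close> it then says that \<open>X\<close> has the same characteristic function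
    under \<open>D\<close> and \<open>M\<close>, and Levy's uniqueness theorem applies.\<close>
  define D where "D = density M (\<lambda>x. ennreal (h x / \<kappa>))"
  have sets_D [measurable_cong, simp]: "sets D = sets M" and space_D [simp]: "space D = space M"
    by (simp_all add: D_def)
  have int_D: "integral\<^sup>L D \<phi> = (\<integral>x. (h x / \<kappa>) *\<^sub>R \<phi> x \<partial>M)"
    if "\<phi> \<in> borel_measurable M" for \<phi> :: "'a \<Rightarrow> 'b :: {banach, second_countable_topology}"
    unfolding D_def by (rule integral_density) (use that h \<kappa> in auto)
  have int_h: "integrable M h"
    by (rule integrable_const_bound[where B = C]) (use h in auto)
  have mean_h: "(\<integral>x. h x \<partial>M) = \<kappa>"
    using char[of 0] by (simp add: prob_space of_real_def[symmetric])
  have "emeasure D (space D) = (\<integral>\<^sup>+x. ennreal (h x / \<kappa>) \<partial>M)"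
    by (simp add: D_def emeasure_density cong: nn_integral_cong)
  also have "\<dots> = 1"
    using int_h mean_h \<kappa> h by (subst nn_integral_eq_integral) auto
  finally interpret D: prob_space D by (rule prob_spaceI)
  have "char (distr D borel X) t = char (distr M borel X) t" for t
    using \<kappa> char[of t] by (simp add: char_def integral_distr int_D scaleR_conv_of_real
        divide_inverse mult.assoc mult.commute[of "of_real (h _)"] mult.left_commute)
  then have "distr D borel X = distr M borel X"
    by (intro Levy_uniqueness D.real_distribution_distr real_distribution_distr) auto
  then have "measure (distr D borel X) A = measure (distr M borel X) A" by simp
  then have "measure D (X -` A \<inter> space M) = prob (X -` A \<inter> space M)"
    by (simp add: measure_distr)
  moreover have "measure D (X -` A \<inter> space M) = (\<integral>x. h x * indicator A (X x) \<partial>M) / \<kappa>"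
  proof -
    have "measure D (X -` A \<inter> space M) = (\<integral>x. indicator (X -` A \<inter> space M) x \<partial>D)"
      by simp
    also have "\<dots> = (\<integral>x. (h x / \<kappa>) *\<^sub>R indicator (X -` A \<inter> space M) x \<partial>M)"
      by (rule int_D) simp
    also have "\<dots> = (\<integral>x. (h x * indicator A (X x)) / \<kappa> \<partial>M)"
      by (intro Bochner_Integration.integral_cong) (auto simp: indicator_def)
    finally show ?thesis by simp
  qed
  ultimately show ?thesis using \<kappa> by (simp add: field_simps)
qed

text \<open>
  For fixed \<open>b\<close> the complex measure with density \<open>exp (\<i> b W)\<close> is recovered from the positive
  densities \<open>2 + cos (b W)\<close> and \<open>2 + sin (b W)\<close>, so that uniqueness of characteristic functions
  of one-dimensional laws suffices.
\<close>

lemma (in prob_space) indep_var_if_char_mult: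
  fixes X W :: "'a \<Rightarrow> real"
  assumes X [measurable]: "random_variable borel X" and W [measurable]: "random_variable borel W"
    and char: "\<And>a b. (\<integral>x. iexp (a * X x + b * W x) \<partial>M) =
      (\<integral>x. iexp (a * X x) \<partial>M) * (\<integral>x. iexp (b * W x) \<partial>M)"
  shows "indep_var borel X borel W"
proof -
  have prod: "prob ((X -` A \<inter> space M) \<inter> (W -` B \<inter> space M)) =
      prob (X -` A \<inter> space M) * prob (W -` B \<inter> space M)"
    if A [measurable]: "A \<in> sets borel" and B [measurable]: "B \<in> sets borel" for A B
  proof -
    define P where "P = prob (X -` A \<inter> space M)"
    have int_iexp: "integrable M (\<lambda>x. iexp (a * X x + b * W x))" for a b
      by (rule integrable_const_bound[where B = 1]) auto
    have int_iexp1: "integrable M (\<lambda>x. iexp (b * X x))" "integrable M (\<lambda>x. iexp (b * W x))" for b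
      using int_iexp[of b 0] int_iexp[of 0 b] by simp_all
    have int_ind: "integrable M (\<lambda>x. indicator A (X x) :: real)"
      by (rule integrable_const_bound[where B = 1]) (auto simp: indicator_def)
    have mean_ind: "(\<integral>x. indicator A (X x) \<partial>M) = P"
    proof -
      have "(\<integral>x. indicator A (X x) \<partial>M) = (\<integral>x. indicat_real (X -` A \<inter> space M) x \<partial>M)"
        by (intro Bochner_Integration.integral_cong) (auto simp: indicator_def)
      then show ?thesis by (simp add: P_def)
    qed
    define \<psi> where "\<psi> b = (\<integral>x. iexp (b * W x) \<partial>M)" for b
    \<comment> \<open>Since \<open>W\<close> is real, the values at \<open>b\<close> and
      \<open>- b\<close> are conjugate, so their half sum and half difference are the real part and
      \<i> times the imaginary part.\<close>
    have \<psi>_minus: "\<psi> (- b) = cnj (\<psi> b)" for b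
    proof -
      have "\<psi> (- b) = (\<integral>x. cnj (iexp (b * W x)) \<partial>M)"
        unfolding \<psi>_def by (intro Bochner_Integration.integral_cong) (auto simp: exp_cnj)
      then show ?thesis by (simp add: \<psi>_def)
    qed
    have int_cos_ind: "integrable M (\<lambda>x. cos (b * W x) * indicator A (X x))"
      and int_sin_ind: "integrable M (\<lambda>x. sin (b * W x) * indicator A (X x))" for b
      by (rule integrable_const_bound[where B = 1]; simp add: indicator_def)+
    have \<psi>_le: "norm (\<psi> b) \<le> 1" for b
    proof -
      have "norm (\<psi> b) \<le> (\<integral>x. norm (iexp (b * W x)) \<partial>M)"
        unfolding \<psi>_def by (rule integral_norm_bound)
      then show ?thesis by (simp add: prob_space)
    qed
    have cos_w: "(\<integral>x. (2 + cos (b * W x)) * indicator A (X x) \<partial>M) = (2 + Re (\<psi> b)) * P" for b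
      unfolding P_def
    proof (rule weighted_char_unique[where C = 3])
      show "2 + Re (\<psi> b) > 0" using \<psi>_le[of b] abs_Re_le_cmod[of "\<psi> b"] by linarith
      fix t
      \<comment> \<open>Euler's formula turns the weight into exponentials with frequencies
        \<open>b\<close> and \<open>- b\<close>, and the factorisation hypothesis applies to
        each.\<close>
      have "(\<integral>x. (2 + cos (b * W x)) *\<^sub>R iexp (t * X x) \<partial>M) =
        (\<integral>x. 2 * iexp (t * X x) + (iexp (t * X x + b * W x) + iexp (t * X x + (-b) * W x)) / 2 \<partial>M)"
        by (intro Bochner_Integration.integral_cong refl)
          (simp add: scaleR_conv_of_real cos_of_real[symmetric] cos_exp_eq exp_add algebra_simps
            exp_diff exp_minus field_simps)
      also have "\<dots> = 2 * (\<integral>x. iexp (t * X x) \<partial>M) +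
          ((\<integral>x. iexp (t * X x) \<partial>M) * \<psi> b + (\<integral>x. iexp (t * X x) \<partial>M) * \<psi> (-b)) / 2"
        using int_iexp[of t b] int_iexp[of t "-b"] int_iexp1[of t] char[of t b] char[of t "-b"]
        by (simp add: \<psi>_def)
      also have "\<dots> = (2 + Re (\<psi> b)) *\<^sub>R (\<integral>x. iexp (t * X x) \<partial>M)"
        by (simp add: \<psi>_minus complex_eq_iff algebra_simps)
      finally show "(\<integral>x. (2 + cos (b * W x)) *\<^sub>R iexp (t * X x) \<partial>M) =
        (2 + Re (\<psi> b)) *\<^sub>R (\<integral>x. iexp (t * X x) \<partial>M)" .
    next
      fix x show "0 \<le> 2 + cos (b * W x)" "2 + cos (b * W x) \<le> 3"
        using cos_ge_minus_one[of "b * W x"] cos_le_one[of "b * W x"] by linarith+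
    qed auto
    have cos_A: "(\<integral>x. cos (b * W x) * indicator A (X x) \<partial>M) = Re (\<psi> b) * P" for b
      using cos_w[of b] int_ind int_cos_ind[of b] mean_ind by (simp add: distrib_right)
    have sin_w: "(\<integral>x. (2 + sin (b * W x)) * indicator A (X x) \<partial>M) = (2 + Im (\<psi> b)) * P" for b
      unfolding P_def
    proof (rule weighted_char_unique[where C = 3])
      show "2 + Im (\<psi> b) > 0" using \<psi>_le[of b] abs_Im_le_cmod[of "\<psi> b"] by linarith
      fix t
      have "(\<integral>x. (2 + sin (b * W x)) *\<^sub>R iexp (t * X x) \<partial>M) =
        (\<integral>x. 2 * iexp (t * X x) - \<i> * (iexp (t * X x + b * W x) - iexp (t * X x + (-b) * W x)) / 2 \<partial>M)"
        by (intro Bochner_Integration.integral_cong refl)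
          (simp add: scaleR_conv_of_real sin_of_real[symmetric] sin_exp_eq exp_add algebra_simps
            exp_diff exp_minus field_simps)
      also have "\<dots> = 2 * (\<integral>x. iexp (t * X x) \<partial>M) -
          \<i> * ((\<integral>x. iexp (t * X x) \<partial>M) * \<psi> b - (\<integral>x. iexp (t * X x) \<partial>M) * \<psi> (-b)) / 2"
        using int_iexp[of t b] int_iexp[of t "-b"] int_iexp1[of t] char[of t b] char[of t "-b"]
        by (simp add: \<psi>_def)
      also have "\<dots> = (2 + Im (\<psi> b)) *\<^sub>R (\<integral>x. iexp (t * X x) \<partial>M)"
        by (simp add: \<psi>_minus complex_eq_iff algebra_simps)
      finally show "(\<integral>x. (2 + sin (b * W x)) *\<^sub>R iexp (t * X x) \<partial>M) =
        (2 + Im (\<psi> b)) *\<^sub>R (\<integral>x. iexp (t * X x) \<partial>M)" .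
    next
      fix x show "0 \<le> 2 + sin (b * W x)" "2 + sin (b * W x) \<le> 3"
        using sin_ge_minus_one[of "b * W x"] sin_le_one[of "b * W x"] by linarith+
    qed auto
    have sin_A: "(\<integral>x. sin (b * W x) * indicator A (X x) \<partial>M) = Im (\<psi> b) * P" for b
      using sin_w[of b] int_ind int_sin_ind[of b] mean_ind by (simp add: distrib_right)
    have int_bind: "integrable M (\<lambda>x. indicator A (X x) *\<^sub>R iexp (t * W x))" for t
      by (rule integrable_const_bound[where B = 1]) (auto simp: indicator_def)
    have iexp_A: "(\<integral>x. indicator A (X x) *\<^sub>R iexp (t * W x) \<partial>M) = P *\<^sub>R \<psi> t" for t
      using integral_Re[OF int_bind[of t]] integral_Im[OF int_bind[of t]] cos_A[of t] sin_A[of t]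
      by (simp add: complex_eq_iff Re_exp Im_exp mult.commute)
    \<comment> \<open>The roles are now exchanged: the weight depends on \<open>X\<close>, and the
      law of \<open>W\<close> is tested. Adding 1 keeps the mean of the weight positive even when
      \<open>P\<close> is 0.\<close>
    have "(\<integral>x. (1 + indicat_real A (X x)) * indicator B (W x) \<partial>M) = (1 + P) * prob (W -` B \<inter> space M)"
    proof (rule weighted_char_unique[where C = 2])
      show "1 + P > 0" by (simp add: P_def add_pos_nonneg)
      fix t
      show "(\<integral>x. (1 + indicator A (X x)) *\<^sub>R iexp (t * W x) \<partial>M) = (1 + P) *\<^sub>R (\<integral>x. iexp (t * W x) \<partial>M)"
        using int_iexp1(2)[of t] int_bind[of t] iexp_A[of t] by (simp add: scaleR_add_left \<psi>_def)
    qed (auto simp: indicator_def)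
    moreover have "(\<integral>x. (1 + indicat_real A (X x)) * indicator B (W x) \<partial>M) =
        (\<integral>x. indicator (W -` B \<inter> space M) x + indicator ((X -` A \<inter> space M) \<inter> (W -` B \<inter> space M)) x \<partial>M)"
      by (intro Bochner_Integration.integral_cong) (auto simp: indicator_def)
    moreover have "\<dots> = prob (W -` B \<inter> space M) + prob ((X -` A \<inter> space M) \<inter> (W -` B \<inter> space M))"
      by (subst Bochner_Integration.integral_add) (auto simp: emeasure_eq_measure)
    ultimately show ?thesis by (simp add: P_def algebra_simps)
  qed
  have Int_stable: "Int_stable {Z -` A \<inter> space M |A. A \<in> sets borel}" for Z :: "'a \<Rightarrow> real"
    unfolding Int_stable_def
  proof clarify
    fix A B :: "real set" assume "A \<in> sets borel" "B \<in> sets borel"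
    then show "\<exists>C. Z -` A \<inter> space M \<inter> (Z -` B \<inter> space M) = Z -` C \<inter> space M \<and> C \<in> sets borel"
      by (intro exI[of _ "A \<inter> B"]) auto
  qed
  show ?thesis
    unfolding indep_var_eq
  proof (intro conjI indep_set_sigma_sets)
    show "indep_set {X -` A \<inter> space M |A. A \<in> sets borel} {W -` A \<inter> space M |A. A \<in> sets borel}"
      unfolding indep_sets2_eq using prod by auto
  qed (auto simp: Int_stable)
qed

subsection \<open>The angular link\<close>

text \<open>Dominated convergence with bound 1, as the link takes values in the unit interval.
  Continuity is joint in angle and score because uniform continuity on compact rectangles is drawn
  from it.\<close>

lemma continuous_on_f_ang:
  assumes \<sigma>: "continuous_on UNIV \<sigma>" "\<And>t. \<sigma> t \<in> {0..1}"
  shows "continuous_on UNIV (\<lambda>(\<theta>, u). f_ang \<sigma> 1 u \<theta>)"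
proof (rule continuous_on_sequentiallyI)
  fix s :: "nat \<Rightarrow> real \<times> real" and a
  assume s: "s \<longlonglongrightarrow> a"
  have \<sigma>_meas [measurable]: "\<sigma> \<in> borel_measurable borel"
    using \<sigma>(1) by (rule borel_measurable_continuous_onI)
  interpret G: real_distribution std_normal_distribution by (rule real_dist_normal_dist)
  have "(\<lambda>i. \<integral>z. \<sigma> (cos (fst (s i)) * snd (s i) + sin (fst (s i)) * z) \<partial>std_normal_distribution)
      \<longlonglongrightarrow> (\<integral>z. \<sigma> (cos (fst a) * snd a + sin (fst a) * z) \<partial>std_normal_distribution)"
  proof (rule integral_dominated_convergence[where w = "\<lambda>_. 1"])
    show "AE z in std_normal_distribution. (\<lambda>i. \<sigma> (cos (fst (s i)) * snd (s i) + sin (fst (s i)) * z))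
        \<longlonglongrightarrow> \<sigma> (cos (fst a) * snd a + sin (fst a) * z)"
      by (intro AE_I2 continuous_on_tendsto_compose[OF \<sigma>(1)] tendsto_intros s) auto
    show "AE z in std_normal_distribution. norm (\<sigma> (cos (fst (s i)) * snd (s i) + sin (fst (s i)) * z)) \<le> 1" for i
      using \<sigma>(2) by (intro AE_I2) auto
  qed simp_all
  then show "(\<lambda>i. case s i of (\<theta>, u) \<Rightarrow> f_ang \<sigma> 1 u \<theta>) \<longlonglongrightarrow> (case a of (\<theta>, u) \<Rightarrow> f_ang \<sigma> 1 u \<theta>)"
    by (simp add: f_ang_def case_prod_unfold)
qed

lemma borel_measurable_f_ang:
  assumes "continuous_on UNIV \<sigma>" "\<And>t. \<sigma> t \<in> {0..1}"
  shows "(\<lambda>u. f_ang \<sigma> 1 u \<theta>) \<in> borel_measurable borel"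
proof (rule borel_measurable_continuous_onI)
  have "continuous_on UNIV ((\<lambda>(\<theta>, u). f_ang \<sigma> 1 u \<theta>) \<circ> Pair \<theta>)"
    by (intro continuous_on_compose continuous_on_subset[OF continuous_on_f_ang[OF assms]] continuous_intros) auto
  then show "continuous_on UNIV (\<lambda>u. f_ang \<sigma> 1 u \<theta>)" by (simp add: o_def)
qed

lemma f_ang_in_unit_interval:
  assumes "continuous_on UNIV \<sigma>" "\<And>t. \<sigma> t \<in> {0..1}"
  shows "f_ang \<sigma> s u \<theta> \<in> {0..1}"
proof -
  interpret G: real_distribution std_normal_distribution by (rule real_dist_normal_dist)
  have [measurable]: "\<sigma> \<in> borel_measurable borel"
    using assms(1) by (rule borel_measurable_continuous_onI)
  have "integrable std_normal_distribution (\<lambda>z. \<sigma> (cos \<theta> * (u / s) + sin \<theta> * z))"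
    by (rule G.integrable_const_bound[where B = 1]) (use assms(2) in auto)
  then have "f_ang \<sigma> s u \<theta> \<le> 1"
    unfolding f_ang_def using assms(2) by (intro G.integral_le_const) auto
  moreover have "f_ang \<sigma> s u \<theta> \<ge> 0"
    unfolding f_ang_def using assms(2) by (intro Bochner_Integration.integral_nonneg) auto
  ultimately show ?thesis by simp
qed

lemma f_ang_equicontinuous_in_angle:
  assumes "continuous_on UNIV \<sigma>" "\<And>t. \<sigma> t \<in> {0..1}" "\<epsilon> > 0"
  obtains \<delta> where "\<delta> > 0"
    "\<And>\<theta> \<theta>' u. \<theta> \<in> {a..b} \<Longrightarrow> \<bar>\<theta>' - \<theta>\<bar> \<le> \<delta> \<Longrightarrow> \<bar>u\<bar> \<le> K \<Longrightarrow>
      \<bar>f_ang \<sigma> 1 u \<theta>' - f_ang \<sigma> 1 u \<theta>\<bar> \<le> \<epsilon>"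
proof -
  \<comment> \<open>The margin of 1 makes room for \<theta>', which may leave \<open>{a..b}\<close>:
    an estimated angle is just a real number.\<close>
  let ?C = "{a - 1..b + 1} \<times> {- K..K}"
  have "uniformly_continuous_on ?C (\<lambda>(\<theta>, u). f_ang \<sigma> 1 u \<theta>)"
    by (intro compact_uniformly_continuous continuous_on_subset[OF continuous_on_f_ang] compact_Times assms) auto
  then obtain \<delta> where \<delta>: "\<delta> > 0" "\<And>v v'. v \<in> ?C \<Longrightarrow> v' \<in> ?C \<Longrightarrow> dist v' v < \<delta> \<Longrightarrow>
      dist (case v' of (\<theta>, u) \<Rightarrow> f_ang \<sigma> 1 u \<theta>) (case v of (\<theta>, u) \<Rightarrow> f_ang \<sigma> 1 u \<theta>) < \<epsilon>"
    unfolding uniformly_continuous_on_def using \<open>\<epsilon> > 0\<close> by metis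
  show thesis
  \<comment> \<open>The bound 1 keeps \<theta>' inside the margin, and halving \<delta> yields the
    strict distance bound.\<close>
  proof (rule that[of "min 1 (\<delta> / 2)"])
    show "min 1 (\<delta> / 2) > 0" using \<delta>(1) by simp
    fix \<theta> \<theta>' u :: real assume "\<theta> \<in> {a..b}" "\<bar>\<theta>' - \<theta>\<bar> \<le> min 1 (\<delta> / 2)" "\<bar>u\<bar> \<le> K"
    then show "\<bar>f_ang \<sigma> 1 u \<theta>' - f_ang \<sigma> 1 u \<theta>\<bar> \<le> \<epsilon>"
      using \<delta>(2)[of "(\<theta>, u)" "(\<theta>', u)"] \<delta>(1)
      by (auto simp: dist_Pair_Pair dist_real_def abs_le_iff)
  qed
qed

subsection \<open>Covariance geometry and Gaussian scores\<close>

lemma inner_cov_commute: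
  assumes "covariance_matrix d S"
  shows "inner_cov d S u v = inner_cov d S v u"
  using assms unfolding inner_cov_def covariance_matrix_def
  by (subst sum.swap) (auto intro!: sum.cong simp: mult_ac)

lemma inner_cov_add_left: "inner_cov d S (\<lambda>i. u i + v i) w = inner_cov d S u w + inner_cov d S v w"
  and inner_cov_add_right: "inner_cov d S w (\<lambda>i. u i + v i) = inner_cov d S w u + inner_cov d S w v"
  and inner_cov_scale_left: "inner_cov d S (\<lambda>i. a * u i) w = a * inner_cov d S u w"
  and inner_cov_scale_right: "inner_cov d S w (\<lambda>i. a * u i) = a * inner_cov d S w u"
  by (simp_all add: inner_cov_def algebra_simps sum.distrib sum_distrib_left)

lemma inner_cov_lincomb:
  assumes "covariance_matrix d S"
  shows "inner_cov d S (\<lambda>i. a * u i + b * v i) (\<lambda>i. a * u i + b * v i) =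
    a\<^sup>2 * inner_cov d S u u + 2 * a * b * inner_cov d S u v + b\<^sup>2 * inner_cov d S v v"
  using inner_cov_commute[OF assms, of v u]
  by (simp add: inner_cov_add_left[where u = "\<lambda>i. a * u i" and v = "\<lambda>i. b * v i"]
      inner_cov_add_right[where u = "\<lambda>i. a * u i" and v = "\<lambda>i. b * v i"]
      inner_cov_scale_left inner_cov_scale_right power2_eq_square algebra_simps)

lemma norm_cov_nonneg: "covariance_matrix d S \<Longrightarrow> norm_cov d S u \<ge> 0"
  and norm_cov_square: "covariance_matrix d S \<Longrightarrow> (norm_cov d S u)\<^sup>2 = inner_cov d S u u"
  by (simp_all add: norm_cov_def covariance_matrix_def)

text \<open>The quadratic form in two multipliers is nonnegative, which bounds its discriminant. The
  form is only semidefinite, so the case of a vanishing \<open>?c\<close> is treated apart: there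
  the form is affine in \<open>r\<close>, which forces \<open>?b\<close> to vanish.\<close>

lemma inner_cov_Cauchy_Schwarz:
  assumes S: "covariance_matrix d S"
  shows "\<bar>inner_cov d S u v\<bar> \<le> norm_cov d S u * norm_cov d S v"
proof -
  let ?a = "inner_cov d S u u" and ?b = "inner_cov d S u v" and ?c = "inner_cov d S v v"
  have nonneg: "t\<^sup>2 * ?a + 2 * t * r * ?b + r\<^sup>2 * ?c \<ge> 0" for t r
    using S inner_cov_lincomb[OF S, of t u r v] by (metis covariance_matrix_def)
  have "?b\<^sup>2 \<le> ?a * ?c"
  proof (cases "?c = 0")
    case True
    have "?b = 0"
    proof (rule ccontr)
      assume "?b \<noteq> 0"
      \<comment> \<open>With \<open>t = 1\<close> this \<open>r\<close> makes the form equal to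
        -1.\<close>
      then show False
        using nonneg[of 1 "- (?a + 1) / (2 * ?b)"] True by (simp add: field_simps)
    qed
    then show ?thesis using True by simp
  next
    case False
    then have "?c > 0" using S by (metis covariance_matrix_def order_le_less)
    \<comment> \<open>The left-hand side is the form at \<open>t = ?c\<close> and
      \<open>r = - ?b\<close>, close to its minimiser in direction.\<close>
    have "?c * (?a * ?c - ?b\<^sup>2) \<ge> 0"
      using nonneg[of ?c "- ?b"] by (simp add: power2_eq_square algebra_simps)
    then show ?thesis using \<open>?c > 0\<close> by (simp add: zero_le_mult_iff)
  qed
  also have "?a * ?c = (norm_cov d S u * norm_cov d S v)\<^sup>2"
    using S by (simp add: power_mult_distrib norm_cov_square)
  finally show ?thesis
    using norm_cov_nonneg[OF S] by (simp add: abs_le_square_iff[symmetric])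
qed

text \<open>Cauchy-Schwarz, with vanishing norms included: division by zero gives 0, which lies in
  the interval. The bound makes \<open>cos\<close> undo \<open>arccos\<close> in
  \<open>angle_cov\<close>.\<close>

lemma correlation_bound:
  assumes "covariance_matrix d S"
  shows "inner_cov d S u v / (norm_cov d S v * norm_cov d S u) \<in> {- 1..1}"
proof -
  let ?q = "inner_cov d S u v / (norm_cov d S v * norm_cov d S u)"
  have "\<bar>?q\<bar> \<le> 1"
  proof -
    have "norm_cov d S v * norm_cov d S u \<ge> 0"
      using norm_cov_nonneg[OF assms] by simp
    then show ?thesis
      using inner_cov_Cauchy_Schwarz[OF assms, of u v]
      by (auto simp: abs_divide abs_mult divide_le_eq_1 mult.commute)
  qed
  then have "?q \<le> 1" "- 1 \<le> ?q" by linarith+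
  then show ?thesis by simp
qed

lemma angle_cov_range:
  assumes "covariance_matrix d S"
  shows "angle_cov d S u v \<in> {0..pi}"
  using correlation_bound[OF assms, of u v] by (simp add: angle_cov_def arccos_lbound arccos_ubound)

section \<open>Linear scores: measurability, and the regression of the true score on the fitted
  one\<close>

lemma dot_lincomb: "dot d (\<lambda>i. a * u i + b * v i) x = a * dot d u x + b * dot d v x"
  by (simp add: dot_def algebra_simps sum.distrib sum_distrib_left)

lemma borel_measurable_dot:
  assumes "sets N = sets (vec_space d)"
  shows "dot d u \<in> borel_measurable N"
proof -
  have "dot d u \<in> borel_measurable (vec_space d)"
    unfolding dot_def vec_space_def by measurable
  then show ?thesis using assms measurable_cong_sets by blast
qed

text \<open>\<open>arccos\<close> is continuous only on [-1, 1]. Clamping its argument gives a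
  function continuous on the whole line, and by \<open>correlation_bound\<close> the clamp changes
  nothing.\<close>

lemma borel_measurable_angle_cov:
  assumes S: "covariance_matrix d S" and w: "w \<in> M \<rightarrow>\<^sub>M vec_space d"
  shows "(\<lambda>\<omega>. angle_cov d S u (w \<omega>)) \<in> borel_measurable M"
proof -
  have w_i [measurable]: "(\<lambda>\<omega>. w \<omega> i) \<in> borel_measurable M" if "i < d" for i
    using measurable_compose[OF w, of "\<lambda>v. v i" borel] that
    unfolding vec_space_def by simp
  let ?\<rho> = "\<lambda>\<omega>. inner_cov d S u (w \<omega>) / (norm_cov d S (w \<omega>) * norm_cov d S u)"
  have "?\<rho> \<in> borel_measurable M"
    unfolding inner_cov_def norm_cov_def by measurable
  moreover have "(\<lambda>r. arccos (max (- 1) (min 1 r))) \<in> borel_measurable borel"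
    by (intro borel_measurable_continuous_onI continuous_intros) auto
  ultimately have "(\<lambda>\<omega>. arccos (max (- 1) (min 1 (?\<rho> \<omega>)))) \<in> borel_measurable M"
    by (rule measurable_compose)
  moreover have "max (- 1) (min 1 (?\<rho> \<omega>)) = ?\<rho> \<omega>" for \<omega>
    using correlation_bound[OF S, of u "w \<omega>"] by simp
  ultimately show ?thesis by (simp add: angle_cov_def)
qed

text \<open>Fubini for the product law of \<open>X\<close> and the residual \<open>W\<close>:
  integrating out \<open>W\<close> at a fixed score gives \<open>f_ang\<close> at the true angle.
  Testing against indicators of score sets expresses E[\<sigma>(V) | X] without choosing a version
  of it.\<close>

lemma integral_f_ang_score:
  assumes S: "covariance_matrix d S" and N: "centered_gaussian d S N"
    and \<sigma>: "continuous_on UNIV \<sigma>" "\<And>t. \<sigma> t \<in> {0..1}"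
    and v: "norm_cov d S v = 1" and w: "norm_cov d S w \<noteq> 0"
    and B [measurable]: "B \<in> sets borel"
  shows "(\<integral>x. indicator B (dot d w x / norm_cov d S w) * \<sigma> (dot d v x) \<partial>N) =
    (\<integral>x. indicator B (dot d w x / norm_cov d S w) *
      f_ang \<sigma> 1 (dot d w x / norm_cov d S w) (angle_cov d S v w) \<partial>N)"
proof -
  let ?G = std_normal_distribution
  define s where "s = norm_cov d S w"
  define \<theta> where "\<theta> = angle_cov d S v w"
  define X where "X x = dot d w x / s" for x
  define W where "W x = dot d v x - cos \<theta> * X x" for x
  interpret N: prob_space N using N by (simp add: centered_gaussian_def)
  interpret G: real_distribution ?G by (rule real_dist_normal_dist)
  have sets_N: "sets N = sets (vec_space d)" using N by (simp add: centered_gaussian_def)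
  note [measurable] = borel_measurable_dot[OF sets_N]
  have X_meas [measurable]: "X \<in> borel_measurable N" unfolding X_def by measurable
  have W_meas [measurable]: "W \<in> borel_measurable N" unfolding W_def by measurable
  have \<sigma>_meas [measurable]: "\<sigma> \<in> borel_measurable borel"
    using \<sigma>(1) by (rule borel_measurable_continuous_onI)
  have s: "s > 0" using w norm_cov_nonneg[OF S, of w] by (simp add: s_def)
  have cos_\<theta>: "cos \<theta> = inner_cov d S v w / s"
    using correlation_bound[OF S, of v w] v by (simp add: \<theta>_def angle_cov_def s_def)
  have sin_\<theta>: "sin \<theta> \<ge> 0"
    using angle_cov_range[OF S, of v w] by (intro sin_ge_zero) (auto simp: \<theta>_def)

  have law: "distr N borel (\<lambda>x. a * X x + b * W x) =
      distr ?G borel (\<lambda>z. sqrt (a\<^sup>2 + (b * sin \<theta>)\<^sup>2) * z)" for a b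
  proof -
    \<comment> \<open>These coefficients write \<open>a * X + b * W\<close> as a single linear
      functional: the part \<open>- b * cos \<theta> * X\<close> of \<open>b * W\<close> is merged
      into the multiple of \<open>w\<close>.\<close>
    let ?u = "\<lambda>i. ((a - b * cos \<theta>) / s) * w i + b * v i"
    have "inner_cov d S ?u ?u = a\<^sup>2 + (b * sin \<theta>)\<^sup>2"
    proof -
      have "inner_cov d S w w = s\<^sup>2" "inner_cov d S v v = 1" "inner_cov d S w v = s * cos \<theta>"
        using norm_cov_square[OF S, of w] norm_cov_square[OF S, of v] v s
          inner_cov_commute[OF S, of w v] by (simp_all add: s_def cos_\<theta>)
      then have "inner_cov d S ?u ?u = (a - b * cos \<theta>)\<^sup>2 + 2 * (a - b * cos \<theta>) * b * cos \<theta> + b\<^sup>2"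
        unfolding inner_cov_lincomb[OF S] using s by (simp add: power_divide)
      also have "\<dots> = a\<^sup>2 + (b * sin \<theta>)\<^sup>2"
        unfolding power_mult_distrib sin_squared_eq by (simp add: power2_eq_square algebra_simps)
      finally show ?thesis .
    qed
    moreover have "dot d ?u = (\<lambda>x. a * X x + b * W x)"
      unfolding fun_eq_iff dot_lincomb by (simp add: X_def W_def diff_divide_distrib algebra_simps)
    moreover have "distr N borel (dot d ?u) = distr ?G borel (\<lambda>z. norm_cov d S ?u * z)"
      using N unfolding centered_gaussian_def by blast
    ultimately show ?thesis by (simp add: norm_cov_def)
  qed
  \<comment> \<open>The exponent has no term in \<open>a * b\<close>, because \<open>W\<close> is
    the true score minus its projection on \<open>X\<close>. This is why the characteristic function
    factorises.\<close>
  have char: "(\<integral>x. iexp (a * X x + b * W x) \<partial>N) = of_real (exp (- (a\<^sup>2 + (b * sin \<theta>)\<^sup>2) / 2))" for a b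
  proof -
    let ?r = "sqrt (a\<^sup>2 + (b * sin \<theta>)\<^sup>2)"
    have "(\<integral>x. iexp (a * X x + b * W x) \<partial>N) = (\<integral>t. iexp t \<partial>distr N borel (\<lambda>x. a * X x + b * W x))"
      by (subst integral_distr) auto
    also have "\<dots> = (\<integral>z. iexp (?r * z) \<partial>?G)"
      unfolding law by (subst integral_distr) auto
    also have "\<dots> = char ?G ?r" by (simp add: char_def)
    finally show ?thesis
      using real_sqrt_pow2[of "a\<^sup>2 + (b * sin \<theta>)\<^sup>2"] by (simp only: char_std_normal_distribution) simp
  qed
  have "N.indep_var borel X borel W"
  proof (rule N.indep_var_if_char_mult)
    fix a b
    show "(\<integral>x. iexp (a * X x + b * W x) \<partial>N) = (\<integral>x. iexp (a * X x) \<partial>N) * (\<integral>x. iexp (b * W x) \<partial>N)"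
      using char[of a b] char[of a 0] char[of 0 b]
      by (simp add: exp_add[symmetric] of_real_mult[symmetric] add_divide_distrib del: of_real_mult)
  qed auto
  then have joint: "distr N borel X \<Otimes>\<^sub>M distr N borel W = distr N (borel \<Otimes>\<^sub>M borel) (\<lambda>x. (X x, W x))"
    by (simp add: N.indep_var_distribution_eq)
  have W_law: "distr N borel W = distr ?G borel (\<lambda>z. sin \<theta> * z)"
    using law[of 0 1] sin_\<theta> by simp

  interpret X: prob_space "distr N borel X" by (rule N.prob_space_distr) simp
  interpret W: prob_space "distr N borel W" by (rule N.prob_space_distr) simp
  interpret XW: pair_prob_space "distr N borel X" "distr N borel W" ..
  let ?h = "\<lambda>(u, t). indicator B u * \<sigma> (cos \<theta> * u + t)"
  have h_meas [measurable]: "?h \<in> borel_measurable (borel \<Otimes>\<^sub>M borel)"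
    by measurable
  have "integrable (distr N borel X \<Otimes>\<^sub>M distr N borel W) ?h"
    by (rule XW.P.integrable_const_bound[where B = 1])
      (use \<sigma>(2) in \<open>auto simp: indicator_def\<close>)
  then have Fubini: "(\<integral>u. \<integral>t. ?h (u, t) \<partial>distr N borel W \<partial>distr N borel X) =
      integral\<^sup>L (distr N borel X \<Otimes>\<^sub>M distr N borel W) ?h"
    by (rule XW.integral_fst')
  have inner: "(\<integral>t. ?h (u, t) \<partial>distr N borel W) = indicator B u * f_ang \<sigma> 1 u \<theta>" for u
    unfolding W_law by (simp add: integral_distr f_ang_def)
  have total: "integral\<^sup>L (distr N borel X \<Otimes>\<^sub>M distr N borel W) ?h =
      (\<integral>x. indicator B (X x) * \<sigma> (dot d v x) \<partial>N)"
    unfolding joint by (subst integral_distr) (auto simp: W_def)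
  have outer: "(\<integral>u. indicator B u * f_ang \<sigma> 1 u \<theta> \<partial>distr N borel X) =
      (\<integral>x. indicator B (X x) * f_ang \<sigma> 1 (X x) \<theta> \<partial>N)"
  proof -
    note [measurable] = borel_measurable_f_ang[OF \<sigma>]
    show ?thesis by (subst integral_distr) auto
  qed
  have "(\<integral>x. indicator B (X x) * \<sigma> (dot d v x) \<partial>N) = (\<integral>x. indicator B (X x) * f_ang \<sigma> 1 (X x) \<theta> \<partial>N)"
    using Fubini unfolding inner total outer by (rule sym)
  then show ?thesis by (simp only: X_def s_def \<theta>_def)
qed

subsection \<open>Calibration of a predictor close to the regression function\<close>

text \<open>From here on the Gaussian structure matters only through \<open>regression\<close>,
  which says that \<open>F (X x)\<close> is the conditional mean of \<open>Y\<close> given the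
  score. \<open>F\<close> stands for the angular link at the true angle and \<open>G\<close> for the
  one at the estimated angle.\<close>

locale score_predictor = prob_space N for N :: "'b measure" +
  fixes X Y :: "'b \<Rightarrow> real" and F G :: "real \<Rightarrow> real"
  assumes X_meas [measurable]: "X \<in> borel_measurable N"
    and Y_meas [measurable]: "Y \<in> borel_measurable N" and Y_range: "Y x \<in> {0..1}"
    and F_meas [measurable]: "F \<in> borel_measurable borel" and F_range: "F u \<in> {0..1}"
    and G_meas [measurable]: "G \<in> borel_measurable borel" and G_range: "G u \<in> {0..1}"
    and regression: "B \<in> sets borel \<Longrightarrow>
      (\<integral>x. indicator B (X x) * Y x \<partial>N) = (\<integral>x. indicator B (X x) * F (X x) \<partial>N)"
begin

lemma integrable_bounded:
  assumes "h \<in> borel_measurable N" "\<And>x. \<bar>h x\<bar> \<le> (C :: real)"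
  shows "integrable N h"
  using assms by (intro integrable_const_bound[where B = C]) auto

text \<open>For scores beyond \<open>K\<close> no closeness is known, but two values in the unit
  interval differ by at most 1, which the indicator supplies.\<close>

lemma prediction_gap_le:
  assumes "e \<ge> 0" "\<And>u. \<bar>u\<bar> \<le> K \<Longrightarrow> \<bar>G u - F u\<bar> \<le> e"
  shows "\<bar>G u - F u\<bar> \<le> e + indicator {u. \<bar>u\<bar> > K} u"
  using assms F_range[of u] G_range[of u] by (cases "\<bar>u\<bar> \<le> K") (auto simp: abs_le_iff)

text \<open>A window around \<open>p\<close> is the preimage of a Borel set of scores, so
  \<open>regression\<close> replaces \<open>Y\<close> by \<open>F (X x)\<close> on it. There
  \<open>p\<close> and \<open>F (X x)\<close> differ by at most \<delta> for the window,
  \<open>e\<close> for the gap, and 1 where the score exceeds \<open>K\<close>. Dividing by the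
  positive mass of the window turns the last term into \<eta>, and \<delta> disappears in the
  limit.\<close>

lemma calibration_error_at_le:
  assumes level: "conditionable_level N (\<lambda>x. G (X x)) Y p"
    and tail: "cond_tail_le N (\<lambda>x. G (X x)) X p K \<eta>"
    and e: "e \<ge> 0" "\<And>u. \<bar>u\<bar> \<le> K \<Longrightarrow> \<bar>G u - F u\<bar> \<le> e"
  shows "\<bar>calibration_error_at N (\<lambda>x. G (X x)) Y p\<bar> \<le> e + \<eta>"
proof -
  have gap: "\<bar>G u - F u\<bar> \<le> e + indicator {u. \<bar>u\<bar> > K} u" for u
    using e by (rule prediction_gap_le)
  let ?L = "level_window N (\<lambda>x. G (X x)) p"
  let ?m = "window_mean N (\<lambda>x. G (X x)) Y p"
  from level obtain c where c: "(?m \<longlongrightarrow> c) (at_right 0)"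
    by (auto simp: conditionable_level_def)
  then have Lim: "cond_exp_at N (\<lambda>x. G (X x)) Y p = c"
    unfolding cond_exp_at_def by (intro tendsto_Lim) auto
  have "\<forall>\<^sub>F \<delta> in at_right 0. \<bar>p - ?m \<delta>\<bar> \<le> \<delta> + e + \<eta>"
    using tail[unfolded cond_tail_le_def] eventually_at_right_less[of "0 :: real"]
  proof eventually_elim
    case (elim \<delta>)
    define B where "B = {u. \<bar>G u - p\<bar> \<le> \<delta>}"
    have B [measurable]: "B \<in> sets borel" unfolding B_def by measurable
    have L: "?L \<delta> = X -` B \<inter> space N" by (auto simp: level_window_def B_def)
    have L_pos: "prob (?L \<delta>) > 0" using level elim(2) by (simp add: conditionable_level_def)
    have int1: "integrable N (\<lambda>x. indicator B (X x) * F (X x))"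
      by (rule integrable_bounded[where C = 1]) (use F_range in \<open>auto simp: indicator_def\<close>)
    have int2: "integrable N (\<lambda>x. indicat_real (?L \<delta>) x)" "integrable N (\<lambda>x. indicat_real {x\<in>?L \<delta>. \<bar>X x\<bar> > K} x)"
      unfolding L by (rule integrable_bounded[where C = 1]; simp add: indicator_def)+
    have meas: "?L \<delta> \<in> sets N" "{x\<in>?L \<delta>. \<bar>X x\<bar> > K} \<in> sets N"
      unfolding L by measurable
    have "set_lebesgue_integral N (?L \<delta>) Y = (\<integral>x. indicator B (X x) * Y x \<partial>N)"
      unfolding set_lebesgue_integral_def L
      by (intro Bochner_Integration.integral_cong) (auto simp: indicator_def)
    also have "\<dots> = (\<integral>x. indicator B (X x) * F (X x) \<partial>N)" by (rule regression) simp
    finally have mean: "set_lebesgue_integral N (?L \<delta>) Y = (\<integral>x. indicator B (X x) * F (X x) \<partial>N)" .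
    have difference: "p * prob (?L \<delta>) - set_lebesgue_integral N (?L \<delta>) Y =
        (\<integral>x. p * indicator (?L \<delta>) x - indicator B (X x) * F (X x) \<partial>N)"
      using int1 int2 meas by (simp add: mean)
    have "\<bar>\<integral>x. p * indicator (?L \<delta>) x - indicator B (X x) * F (X x) \<partial>N\<bar> \<le>
        (\<integral>x. (\<delta> + e) * indicator (?L \<delta>) x + indicator {x\<in>?L \<delta>. \<bar>X x\<bar> > K} x \<partial>N)"
    proof -
      have "\<bar>p * indicator (?L \<delta>) x - indicator B (X x) * F (X x)\<bar> \<le>
          (\<delta> + e) * indicator (?L \<delta>) x + indicator {x\<in>?L \<delta>. \<bar>X x\<bar> > K} x"
        if "x \<in> space N" for x
        using gap[of "X x"] that
        by (auto simp: L B_def indicator_def abs_le_iff split: if_splits)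
      then show ?thesis
        using int1 int2 by (intro order_trans[OF integral_abs_bound] integral_mono) auto
    qed
    moreover have "(\<integral>x. (\<delta> + e) * indicator (?L \<delta>) x + indicator {x\<in>?L \<delta>. \<bar>X x\<bar> > K} x \<partial>N) =
        (\<delta> + e) * prob (?L \<delta>) + prob {x\<in>?L \<delta>. \<bar>X x\<bar> > K}"
      using int2 meas by simp
    ultimately have "\<bar>p * prob (?L \<delta>) - set_lebesgue_integral N (?L \<delta>) Y\<bar> \<le> (\<delta> + e + \<eta>) * prob (?L \<delta>)"
      using elim(1) unfolding difference distrib_right by linarith
    then have "\<bar>p * prob (?L \<delta>) - set_lebesgue_integral N (?L \<delta>) Y\<bar> / prob (?L \<delta>) \<le> \<delta> + e + \<eta>"
      using L_pos by (simp add: divide_le_eq)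
    moreover have "\<bar>p - ?m \<delta>\<bar> = \<bar>p * prob (?L \<delta>) - set_lebesgue_integral N (?L \<delta>) Y\<bar> / prob (?L \<delta>)"
    proof -
      have "p - ?m \<delta> = (p * prob (?L \<delta>) - set_lebesgue_integral N (?L \<delta>) Y) / prob (?L \<delta>)"
        using L_pos by (simp add: window_mean_def diff_divide_distrib)
      then show ?thesis by simp
    qed
    ultimately show ?case by simp
  qed
  moreover have "((\<lambda>\<delta>. \<bar>p - ?m \<delta>\<bar>) \<longlongrightarrow> \<bar>p - c\<bar>) (at_right 0)"
    by (intro tendsto_intros c)
  moreover have "((\<lambda>\<delta>. \<delta> + e + \<eta>) \<longlongrightarrow> 0 + e + \<eta>) (at_right 0)"
    by (intro tendsto_intros)
  ultimately have "\<bar>p - c\<bar> \<le> 0 + e + \<eta>"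
    by (intro tendsto_le[of "at_right 0"]) auto
  then show ?thesis by (simp add: calibration_error_at_def Lim)
qed

text \<open>Preimages under \<open>f\<close> lie in the generated sigma-algebra, so the defining
  property of conditional expectation applies to them. A version \<open>m\<close> need not be
  bounded at every level; its integrability is inherited from \<open>real_cond_exp\<close>.\<close>

lemma cond_exp_version_integral:
  assumes m: "cond_exp_version N f Y m" and f [measurable]: "f \<in> borel_measurable N"
    and A [measurable]: "A \<in> sets borel"
  shows "integrable N (\<lambda>x. m (f x))"
    "(\<integral>x. indicator A (f x) * m (f x) \<partial>N) = (\<integral>x. indicator A (f x) * Y x \<partial>N)"
proof -
  let ?S = "vimage_algebra (space N) f borel"
  have [measurable]: "m \<in> borel_measurable borel"
    and AE: "AE x in N. real_cond_exp N ?S Y x = m (f x)"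
    using m by (auto simp: cond_exp_version_def)
  have "subalgebra N ?S"
    using measurable_sets[OF f] by (auto simp: subalgebra_def sets_vimage_algebra2)
  then interpret S: finite_measure_subalgebra N ?S
    by unfold_locales
  have Y: "integrable N Y" by (rule integrable_bounded[where C = 1]) (use Y_range in auto)
  have "integrable N (real_cond_exp N ?S Y)" by (rule S.real_cond_exp_int(1)[OF Y])
  then show "integrable N (\<lambda>x. m (f x))"
    by (rule Bochner_Integration.integrable_cong_AE_imp) (use AE in auto)
  have "f -` A \<inter> space N \<in> sets ?S" by (rule in_vimage_algebra) simp
  then have "set_lebesgue_integral N (f -` A \<inter> space N) Y =
      set_lebesgue_integral N (f -` A \<inter> space N) (real_cond_exp N ?S Y)"
    by (rule S.real_cond_exp_intA[OF Y])
  also have "\<dots> = (\<integral>x. indicator A (f x) * m (f x) \<partial>N)"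
    unfolding set_lebesgue_integral_def
    by (intro integral_cong_AE) (use AE in \<open>auto simp: indicator_def\<close>)
  also have "set_lebesgue_integral N (f -` A \<inter> space N) Y = (\<integral>x. indicator A (f x) * Y x \<partial>N)"
    unfolding set_lebesgue_integral_def
    by (intro Bochner_Integration.integral_cong) (auto simp: indicator_def)
  finally show "(\<integral>x. indicator A (f x) * m (f x) \<partial>N) = (\<integral>x. indicator A (f x) * Y x \<partial>N)" ..
qed

text \<open>Markov's inequality, applied separately to the levels \<open>P\<close> and
  \<open>Q\<close> where \<open>p - m p\<close> is large with either sign. The split is needed
  because a version is known only through integrals against level sets: on each part
  \<open>m (f x)\<close> may be exchanged for \<open>F (X x)\<close>, whereas inside an absolute
  value it may not.\<close>

lemma cond_exp_version_deviation_le: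
  assumes m: "cond_exp_version N (\<lambda>x. G (X x)) Y m"
    and e: "e \<ge> 0" "\<And>u. \<bar>u\<bar> \<le> K \<Longrightarrow> \<bar>G u - F u\<bar> \<le> e"
    and \<epsilon>: "\<epsilon> > 0"
  shows "\<epsilon> * measure (distr N borel (\<lambda>x. G (X x))) {p\<in>R. \<bar>p - m p\<bar> > \<epsilon>} \<le> e + prob {x\<in>space N. \<bar>X x\<bar> > K}"
proof -
  have gap: "\<bar>G u - F u\<bar> \<le> e + indicator {u. \<bar>u\<bar> > K} u" for u
    using e by (rule prediction_gap_le)
  have m_meas [measurable]: "m \<in> borel_measurable borel"
    using m by (auto simp: cond_exp_version_def)
  define P where "P = {p. p - m p > \<epsilon>}"
  define Q where "Q = {p. m p - p > \<epsilon>}"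
  have [measurable]: "P \<in> sets borel" "Q \<in> sets borel" unfolding P_def Q_def by measurable
  let ?f = "\<lambda>x. G (X x)"
  let ?h = "\<lambda>p. indicat_real P p - indicat_real Q p"
  note version = cond_exp_version_integral[OF m]
  have int: "integrable N (\<lambda>x. indicator A (?f x) * ?f x)" "integrable N (\<lambda>x. indicator A (?f x) * Y x)"
    "integrable N (\<lambda>x. indicator A (?f x) * F (X x))" if [measurable]: "A \<in> sets borel" for A
    by (rule integrable_bounded[where C = 1]; use G_range F_range Y_range in \<open>simp add: indicator_def\<close>)+
  have int_m: "integrable N (\<lambda>x. indicator A (?f x) * m (?f x))" if [measurable]: "A \<in> sets borel" for A
    by (rule Bochner_Integration.integrable_bound[OF version(1)]) (auto simp: indicator_def)
  have Y_F: "(\<integral>x. indicator A (?f x) * Y x \<partial>N) = (\<integral>x. indicator A (?f x) * F (X x) \<partial>N)"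
    if [measurable]: "A \<in> sets borel" for A
    using regression[of "G -` A"] measurable_sets[OF G_meas that] by (simp add: indicator_def)
  have eq: "(\<integral>x. indicator A (?f x) * (?f x - m (?f x)) \<partial>N) = (\<integral>x. indicator A (?f x) * (?f x - F (X x)) \<partial>N)"
    if A [measurable]: "A \<in> sets borel" for A
    using int[OF A] int_m[OF A] version(2)[OF _ A] Y_F[OF A] by (simp add: right_diff_distrib)
  have int_diff: "integrable N (\<lambda>x. indicator A (?f x) * (?f x - m (?f x)))"
    "integrable N (\<lambda>x. indicator A (?f x) * (?f x - F (X x)))" if A: "A \<in> sets borel" for A
    using int[OF A] int_m[OF A] by (simp_all add: right_diff_distrib)
  let ?D = "{x\<in>space N. \<bar>?f x - m (?f x)\<bar> > \<epsilon>}"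
  have D_meas: "?D \<in> sets N" by measurable
  have tail_meas: "{x\<in>space N. \<bar>X x\<bar> > K} \<in> sets N" by measurable
  have "\<epsilon> * prob ?D = (\<integral>x. \<epsilon> * indicator ?D x \<partial>N)" using D_meas by simp
  also have "\<dots> \<le> (\<integral>x. indicator P (?f x) * (?f x - m (?f x)) - indicator Q (?f x) * (?f x - m (?f x)) \<partial>N)"
  proof (rule integral_mono)
    show "integrable N (\<lambda>x. \<epsilon> * indicator ?D x)"
      using D_meas by (simp add: emeasure_eq_measure)
    show "\<epsilon> * indicator ?D x \<le> indicator P (?f x) * (?f x - m (?f x)) - indicator Q (?f x) * (?f x - m (?f x))"
      if "x \<in> space N" for x
      using \<epsilon> by (auto simp: indicator_def P_def Q_def)
  qed (auto intro!: Bochner_Integration.integrable_diff int_diff)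
  also have "\<dots> = (\<integral>x. indicator P (?f x) * (?f x - F (X x)) - indicator Q (?f x) * (?f x - F (X x)) \<partial>N)"
    using int_diff[of P] int_diff[of Q] eq[of P] eq[of Q] by simp
  also have "\<dots> \<le> (\<integral>x. e + indicator {x\<in>space N. \<bar>X x\<bar> > K} x \<partial>N)"
  proof (rule integral_mono)
    show "integrable N (\<lambda>x. e + indicator {x\<in>space N. \<bar>X x\<bar> > K} x)"
      using tail_meas by (simp add: emeasure_eq_measure)
    show "indicator P (?f x) * (?f x - F (X x)) - indicator Q (?f x) * (?f x - F (X x)) \<le>
        e + indicator {x\<in>space N. \<bar>X x\<bar> > K} x" if "x \<in> space N" for x
      using gap[of "X x"] that \<epsilon> e(1)
      by (auto simp: indicator_def P_def Q_def abs_le_iff split: if_splits)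
  qed (auto intro!: Bochner_Integration.integrable_diff int_diff)
  also have "\<dots> = e + prob {x\<in>space N. \<bar>X x\<bar> > K}"
    using tail_meas by (simp add: emeasure_eq_measure prob_space)
  finally have D: "\<epsilon> * prob ?D \<le> e + prob {x\<in>space N. \<bar>X x\<bar> > K}" .
  \<comment> \<open>\<open>R\<close> is an arbitrary set, so the set of bad levels may fail to be
    measurable; its \<open>measure\<close> is then 0 by convention.\<close>
  have "measure (distr N borel ?f) {p\<in>R. \<bar>p - m p\<bar> > \<epsilon>} \<le> prob ?D"
  proof (cases "{p\<in>R. \<bar>p - m p\<bar> > \<epsilon>} \<in> sets borel")
    case True
    then show ?thesis by (subst measure_distr) (auto intro!: finite_measure_mono D_meas)
  next
    case False
    then show ?thesis by (simp add: measure_notin_sets)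
  qed
  then show ?thesis using D \<epsilon> by (meson mult_left_mono order_trans less_imp_le)
qed

end

subsection \<open>Convergence in probability\<close>

lemma (in real_distribution) exists_tail_le:
  assumes "\<eta> > 0"
  obtains K where "measure M {z. \<bar>z\<bar> > K} \<le> \<eta>"
proof -
  have "(\<lambda>i. measure M {z. \<bar>z\<bar> > real i}) \<longlonglongrightarrow> measure M (\<Inter>i. {z. \<bar>z\<bar> > real i})"
    by (rule finite_Lim_measure_decseq) (auto simp: decseq_def)
  moreover have "(\<Inter>i. {z :: real. \<bar>z\<bar> > real i}) = {}"
  proof -
    have "\<exists>i. \<not> \<bar>z\<bar> > real i" for z
      using real_arch_simple[of "\<bar>z\<bar>"] by (simp add: not_less)
    then show ?thesis by blast
  qed
  ultimately have "\<forall>\<^sub>F i in sequentially. measure M {z. \<bar>z\<bar> > real i} < \<eta>"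
    using assms by (intro order_tendstoD) auto
  then show thesis
    using that by (auto simp: eventually_sequentially intro: less_imp_le)
qed

text \<open>Standardising cancels the scale of the Gaussian projection. The resulting law is the
  same for every instance and every estimator of nonzero norm, so a single tail cutoff serves them
  all.\<close>

lemma measure_standardized_score:
  assumes N: "centered_gaussian d S N" and w: "norm_cov d S w \<noteq> 0" and A [measurable]: "A \<in> sets borel"
  shows "measure N {x\<in>space N. dot d w x / norm_cov d S w \<in> A} = measure std_normal_distribution A"
proof -
  let ?s = "norm_cov d S w"
  have sets_N: "sets N = sets (vec_space d)" using N by (simp add: centered_gaussian_def)
  note [measurable] = borel_measurable_dot[OF sets_N]
  let ?B = "(\<lambda>r. r / ?s) -` A"
  have B: "?B \<in> sets borel" using measurable_sets[of "\<lambda>r. r / ?s" borel borel A] by simp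
  have "{x\<in>space N. dot d w x / ?s \<in> A} = dot d w -` ?B \<inter> space N" by auto
  then have "measure N {x\<in>space N. dot d w x / ?s \<in> A} = measure (distr N borel (dot d w)) ?B"
    using B by (simp add: measure_distr)
  also have "distr N borel (dot d w) = distr std_normal_distribution borel (\<lambda>z. ?s * z)"
    using N by (simp add: centered_gaussian_def)
  also have "measure \<dots> ?B = measure std_normal_distribution A"
    using B w by (subst measure_distr) (auto intro!: arg_cong[where f = "measure std_normal_distribution"])
  finally show ?thesis .
qed

section \<open>The Gaussian model as an instance of the abstract predictor\<close>

lemma score_predictor_f_ang:
  assumes S: "covariance_matrix d S" and N: "centered_gaussian d S N"
    and \<sigma>: "continuous_on UNIV \<sigma>" "\<And>t. \<sigma> t \<in> {0..1}"
    and v: "norm_cov d S v = 1" and w: "norm_cov d S w \<noteq> 0"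
  shows "score_predictor N (\<lambda>x. dot d w x / norm_cov d S w) (\<lambda>x. \<sigma> (dot d v x))
    (\<lambda>u. f_ang \<sigma> 1 u (angle_cov d S v w)) (\<lambda>u. f_ang \<sigma> 1 u \<theta>)"
proof -
  interpret prob_space N using N by (simp add: centered_gaussian_def)
  have sets_N: "sets N = sets (vec_space d)" using N by (simp add: centered_gaussian_def)
  note [measurable] = borel_measurable_dot[OF sets_N]
  have [measurable]: "\<sigma> \<in> borel_measurable borel"
    using \<sigma>(1) by (rule borel_measurable_continuous_onI)
  show ?thesis
  proof
    show "(\<integral>x. indicator B (dot d w x / norm_cov d S w) * \<sigma> (dot d v x) \<partial>N) =
        (\<integral>x. indicator B (dot d w x / norm_cov d S w) *
          f_ang \<sigma> 1 (dot d w x / norm_cov d S w) (angle_cov d S v w) \<partial>N)" if "B \<in> sets borel" for B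
      by (rule integral_f_ang_score[OF assms that])
  qed (measurable; intro borel_measurable_f_ang f_ang_in_unit_interval \<sigma>)+
qed

text \<open>The norm is moved into the score, which is why the analytic facts about
  \<open>f_ang\<close> are stated with norm argument 1.\<close>

lemma angular_predictor_eq:
  "angular_predictor d S \<sigma> w \<theta> = (\<lambda>x. f_ang \<sigma> 1 (dot d w x / norm_cov d S w) \<theta>)"
  by (simp add: angular_predictor_def f_ang_def fun_eq_iff)

text \<open>Up to a null set, \<open>X k\<close> can exceed \<epsilon> only outside
  \<open>E k\<close> or where \<open>Z k\<close> exceeds \<delta>. The first event has probability
  at most \<eta> eventually, and the second tends to probability 0. The tolerance \<delta> must not
  depend on \<open>k\<close>.\<close>

lemma tendsto_0_in_probI:
  assumes prob: "\<And>k. prob_space (M k)"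
    and Z: "\<And>k. Z k \<in> borel_measurable (M k)" "tendsto_0_in_prob M Z"
    and dominated: "\<And>\<epsilon> \<eta>. \<epsilon> > 0 \<Longrightarrow> 0 < \<eta> \<Longrightarrow> \<eta> < 1 \<Longrightarrow>
      \<exists>\<delta>>0. \<exists>E. (\<forall>\<^sub>F k in sequentially. measure (M k) (E k) \<ge> 1 - \<eta>) \<and>
        (\<forall>k. AE \<omega> in M k. \<omega> \<in> E k \<longrightarrow> \<bar>Z k \<omega>\<bar> \<le> \<delta> \<longrightarrow> \<bar>X k \<omega>\<bar> \<le> \<epsilon>)"
  shows "tendsto_0_in_prob M X"
  unfolding tendsto_0_in_prob_def
proof (intro allI impI)
  fix \<epsilon> :: real assume "\<epsilon> > 0"
  let ?X = "\<lambda>k. {\<omega>\<in>space (M k). \<bar>X k \<omega>\<bar> > \<epsilon>}"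
  show "(\<lambda>k. measure (M k) (?X k)) \<longlonglongrightarrow> 0"
  proof (rule order_tendstoI)
    fix r :: real assume "r > 0"
    \<comment> \<open>Half of \<open>r\<close> pays for the complement of \<open>E k\<close> and
      half for large \<open>Z k\<close>; the cap 1/2 secures \<eta> < 1.\<close>
    define \<eta> where "\<eta> = min (r / 2) (1 / 2)"
    have \<eta>: "0 < \<eta>" "\<eta> < 1" "\<eta> \<le> r / 2" using \<open>r > 0\<close> by (auto simp: \<eta>_def)
    obtain \<delta> E where "\<delta> > 0" and E: "\<forall>\<^sub>F k in sequentially. measure (M k) (E k) \<ge> 1 - \<eta>"
      and AE: "\<forall>k. AE \<omega> in M k. \<omega> \<in> E k \<longrightarrow> \<bar>Z k \<omega>\<bar> \<le> \<delta> \<longrightarrow> \<bar>X k \<omega>\<bar> \<le> \<epsilon>"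
      using dominated[OF \<open>\<epsilon> > 0\<close> \<eta>(1,2)] by (elim exE conjE) (rule that)
    let ?Z = "\<lambda>k. {\<omega>\<in>space (M k). \<bar>Z k \<omega>\<bar> > \<delta>}"
    have "(\<lambda>k. measure (M k) (?Z k)) \<longlonglongrightarrow> 0"
      using Z(2) \<open>\<delta> > 0\<close> unfolding tendsto_0_in_prob_def by blast
    then have "\<forall>\<^sub>F k in sequentially. measure (M k) (?Z k) < r / 2"
      using \<open>r > 0\<close> by (intro order_tendstoD) auto
    with E show "\<forall>\<^sub>F k in sequentially. measure (M k) (?X k) < r"
    proof eventually_elim
      case (elim k)
      interpret prob_space "M k" by (rule prob)
      \<comment> \<open>A non-measurable set has \<open>measure\<close> 0, so the lower bound 1 -
        \<eta>, positive because \<eta> < 1, forces \<open>E k\<close> to be measurable.\<close>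
      have E_meas: "E k \<in> events"
        using elim(1) \<eta>(2) measure_notin_sets[of "E k" "M k"] by fastforce
      have Z_meas: "?Z k \<in> events" using Z(1)[of k] by measurable
      show ?case
      proof (cases "?X k \<in> events")
        case True
        have "prob (?X k) \<le> prob ((space (M k) - E k) \<union> ?Z k)"
        proof (rule finite_measure_mono_AE)
          show "AE \<omega> in M k. \<omega> \<in> ?X k \<longrightarrow> \<omega> \<in> (space (M k) - E k) \<union> ?Z k"
            using AE[THEN spec, of k] by eventually_elim auto
          show "(space (M k) - E k) \<union> ?Z k \<in> events" using E_meas Z_meas by blast
        qed
        also have "\<dots> \<le> prob (space (M k) - E k) + prob (?Z k)"
          using E_meas Z_meas by (intro measure_Un_le) auto
        also have "prob (space (M k) - E k) = 1 - prob (E k)"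
          by (rule prob_compl[OF E_meas])
        finally show ?thesis using elim \<eta>(3) by linarith
      next
        case False \<comment> \<open>a non-measurable set has \<^const>\<open>measure\<close> 0\<close>
        then show ?thesis using \<open>r > 0\<close> by (simp add: measure_notin_sets)
      qed
    qed
  qed (auto intro!: always_eventually less_le_trans[OF _ measure_nonneg])
qed

text \<open>The order of choices is essential: a cutoff \<open>K\<close> for the score comes before
  the tolerance \<delta> for the angle error, because the two predictors are uniformly close only on
  bounded scores. The two conclusions differ in where \<open>K\<close> comes from.\<close>

theorem theorem3p2:
  fixes M :: "nat \<Rightarrow> 'a measure"
    and d n :: "nat \<Rightarrow> nat"
    and \<gamma> :: real
    and \<Sigma> :: "nat \<Rightarrow> nat \<Rightarrow> nat \<Rightarrow> real"
    and N :: "nat \<Rightarrow> (nat \<Rightarrow> real) measure"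
    and \<sigma> :: "real \<Rightarrow> real"
    and w_star :: "nat \<Rightarrow> nat \<Rightarrow> real"
    and x :: "nat \<Rightarrow> nat \<Rightarrow> 'a \<Rightarrow> nat \<Rightarrow> real"
    and y :: "nat \<Rightarrow> nat \<Rightarrow> 'a \<Rightarrow> bool"
    and loss :: "bool \<Rightarrow> real \<Rightarrow> real"
    and g :: "nat \<Rightarrow> (nat \<Rightarrow> real) \<Rightarrow> real"
    and w_hat :: "nat \<Rightarrow> 'a \<Rightarrow> nat \<Rightarrow> real"
    and \<theta>_hat :: "nat \<Rightarrow> 'a \<Rightarrow> real"
  defines "\<theta>_star \<equiv> \<lambda>k \<omega>. angle_cov (d k) (\<Sigma> k) (w_star k) (w_hat k \<omega>)"
    and "f \<equiv> \<lambda>k \<omega>. angular_predictor (d k) (\<Sigma> k) \<sigma> (w_hat k \<omega>) (\<theta>_hat k \<omega>)"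
    and "Y \<equiv> \<lambda>k v. \<sigma> (dot (d k) (w_star k) v)"
    and "U \<equiv> \<lambda>k \<omega> v. dot (d k) (w_hat k \<omega>) v / norm_cov (d k) (\<Sigma> k) (w_hat k \<omega>)"
  assumes d_lim: "filterlim d at_top sequentially"
    and n_lim: "filterlim n at_top sequentially"
    and ratio_lim: "(\<lambda>k. real (n k) / real (d k)) \<longlonglongrightarrow> \<gamma>" "\<gamma> > 0"
    and link: "continuous_on UNIV \<sigma>" "\<And>t. \<sigma> t \<in> {0..1}"
    and cov: "\<And>k. covariance_matrix (d k) (\<Sigma> k)"
    and gauss: "\<And>k. centered_gaussian (d k) (\<Sigma> k) (N k)"
    and w_star: "\<And>k. w_star k \<in> space (vec_space (d k))"
      "\<And>k. norm_cov (d k) (\<Sigma> k) (w_star k) = 1"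
    and prob: "\<And>k. prob_space (M k)"
    and x_law: "\<And>k i. i < n k \<Longrightarrow> x k i \<in> M k \<rightarrow>\<^sub>M vec_space (d k)"
      "\<And>k i. i < n k \<Longrightarrow> distr (M k) (vec_space (d k)) (x k i) = N k"
    and y_law: "\<And>k i. i < n k \<Longrightarrow> y k i \<in> M k \<rightarrow>\<^sub>M count_space UNIV"
      "\<And>k i. i < n k \<Longrightarrow> AE \<omega> in M k.
         real_cond_exp (M k) (vimage_algebra (space (M k)) (x k i) (vec_space (d k)))
           (indicator {\<omega>. y k i \<omega>}) \<omega> = \<sigma> (dot (d k) (w_star k) (x k i \<omega>))"
    and indep: "\<And>k. prob_space.indep_vars (M k)
         (\<lambda>_. vec_space (d k) \<Otimes>\<^sub>M count_space UNIV) (\<lambda>i \<omega>. (x k i \<omega>, y k i \<omega>)) {..<n k}"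
    and convex: "\<And>b. convex_on UNIV (loss b)" "\<And>k. convex_penalty (d k) (g k)"
    and w_hat: "\<And>k. w_hat k \<in> M k \<rightarrow>\<^sub>M vec_space (d k)"
      "\<And>k. AE \<omega> in M k. is_arg_min
         (empirical_objective (d k) (n k) loss (g k) (\<lambda>i. x k i \<omega>) (\<lambda>i. y k i \<omega>))
         (\<lambda>w. w \<in> space (vec_space (d k))) (w_hat k \<omega>)"
      "\<And>k. AE \<omega> in M k. norm_cov (d k) (\<Sigma> k) (w_hat k \<omega>) \<noteq> 0"
    and \<theta>_hat: "\<And>k. \<theta>_hat k \<in> borel_measurable (M k)"
      "tendsto_0_in_prob M (\<lambda>k \<omega>. \<theta>_hat k \<omega> - \<theta>_star k \<omega>)"
  shows "(\<forall>p\<in>range \<sigma>. nondegenerate_level M N f Y U p \<longrightarrow>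
            tendsto_0_in_prob M (\<lambda>k \<omega>. calibration_error_at (N k) (f k \<omega>) (Y k) p)) \<and>
         (\<forall>m. (\<forall>k. AE \<omega> in M k. cond_exp_version (N k) (f k \<omega>) (Y k) (m k \<omega>)) \<longrightarrow>
            (\<forall>\<epsilon>>0. tendsto_0_in_prob M (\<lambda>k \<omega>.
               measure (distr (N k) borel (f k \<omega>)) {p\<in>range \<sigma>. \<bar>p - m k \<omega> p\<bar> > \<epsilon>})))"
proof -
  define Z where "Z = (\<lambda>k \<omega>. \<theta>_hat k \<omega> - \<theta>_star k \<omega>)"
  have Z: "Z k \<in> borel_measurable (M k)" for k
    unfolding Z_def \<theta>_star_def
    by (intro borel_measurable_diff \<theta>_hat(1) borel_measurable_angle_cov[OF cov w_hat(1)])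
  have Z_lim: "tendsto_0_in_prob M Z" using \<theta>_hat(2) by (simp add: Z_def)
  define F where "F k \<omega> = (\<lambda>u. f_ang \<sigma> 1 u (\<theta>_star k \<omega>))" for k \<omega>
  define G where "G k \<omega> = (\<lambda>u. f_ang \<sigma> 1 u (\<theta>_hat k \<omega>))" for k \<omega>
  have f_eq: "f k \<omega> = (\<lambda>x. G k \<omega> (U k \<omega> x))" for k \<omega>
    by (simp add: f_def G_def U_def angular_predictor_eq)
  have predictor: "score_predictor (N k) (U k \<omega>) (Y k) (F k \<omega>) (G k \<omega>)"
    if "norm_cov (d k) (\<Sigma> k) (w_hat k \<omega>) \<noteq> 0" for k \<omega>
    unfolding U_def Y_def F_def G_def \<theta>_star_def
    by (intro score_predictor_f_ang cov gauss link w_star(2) that)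
  \<comment> \<open>One \<delta> serves all \<open>k\<close> and \<open>\<omega>\<close>, since the
    true angles share the compact range \<open>{0..pi}\<close> and the link does not vary with
    \<open>k\<close>.\<close>
  have close: "\<exists>\<delta>>0. \<forall>k \<omega> u. \<bar>Z k \<omega>\<bar> \<le> \<delta> \<longrightarrow> \<bar>u\<bar> \<le> K \<longrightarrow> \<bar>G k \<omega> u - F k \<omega> u\<bar> \<le> e"
    if e: "e > 0" for e K
  proof -
    obtain \<delta> where \<delta>: "\<delta> > 0" "\<And>\<theta> \<theta>' u. \<theta> \<in> {0..pi} \<Longrightarrow> \<bar>\<theta>' - \<theta>\<bar> \<le> \<delta> \<Longrightarrow> \<bar>u\<bar> \<le> K \<Longrightarrow>
        \<bar>f_ang \<sigma> 1 u \<theta>' - f_ang \<sigma> 1 u \<theta>\<bar> \<le> e"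
      by (rule f_ang_equicontinuous_in_angle[OF link e, where a = 0 and b = pi and K = K]) (rule that; blast)
    have "\<theta>_star k \<omega> \<in> {0..pi}" for k \<omega>
      unfolding \<theta>_star_def by (rule angle_cov_range[OF cov])
    then show ?thesis using \<delta> by (auto simp: Z_def F_def G_def)
  qed
  show ?thesis
  proof (intro conjI ballI allI impI)
    fix p assume nondegenerate: "nondegenerate_level M N f Y U p"
    show "tendsto_0_in_prob M (\<lambda>k \<omega>. calibration_error_at (N k) (f k \<omega>) (Y k) p)"
    proof (rule tendsto_0_in_probI[OF prob Z Z_lim])
      fix \<epsilon> \<eta> :: real assume "\<epsilon> > 0" "0 < \<eta>" "\<eta> < 1"
      \<comment> \<open>\<open>nondegenerate_level\<close> uses one number both for the exceptional
        probability and for the conditional tail: the first must not exceed \<eta>, while the second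
        takes half of \<epsilon>.\<close>
      define \<eta>' where "\<eta>' = min \<eta> (\<epsilon> / 2)"
      have "\<eta>' > 0" using \<open>\<epsilon> > 0\<close> \<open>\<eta> > 0\<close> by (simp add: \<eta>'_def)
      define E where "E K k = {\<omega>\<in>space (M k). conditionable_level (N k) (f k \<omega>) (Y k) p \<and>
          cond_tail_le (N k) (f k \<omega>) (U k \<omega>) p K \<eta>'}" for K k
      obtain K where K: "\<forall>\<^sub>F k in sequentially. measure (M k) (E K k) \<ge> 1 - \<eta>'"
        using nondegenerate \<open>\<eta>' > 0\<close> unfolding nondegenerate_level_def E_def by blast
      obtain \<delta> where \<delta>: "\<delta> > 0"
        "\<And>k \<omega> u. \<bar>Z k \<omega>\<bar> \<le> \<delta> \<Longrightarrow> \<bar>u\<bar> \<le> K \<Longrightarrow> \<bar>G k \<omega> u - F k \<omega> u\<bar> \<le> \<epsilon> / 2"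
        using close[of "\<epsilon> / 2" K] \<open>\<epsilon> > 0\<close> by auto
      show "\<exists>\<delta>>0. \<exists>E. (\<forall>\<^sub>F k in sequentially. measure (M k) (E k) \<ge> 1 - \<eta>) \<and>
          (\<forall>k. AE \<omega> in M k. \<omega> \<in> E k \<longrightarrow> \<bar>Z k \<omega>\<bar> \<le> \<delta> \<longrightarrow>
            \<bar>calibration_error_at (N k) (f k \<omega>) (Y k) p\<bar> \<le> \<epsilon>)"
      proof (intro exI[of _ \<delta>] exI[of _ "E K"] conjI allI)
        show "\<delta> > 0" by (rule \<delta>(1))
        show "\<forall>\<^sub>F k in sequentially. measure (M k) (E K k) \<ge> 1 - \<eta>"
          using K by eventually_elim (simp add: \<eta>'_def)
        fix k
        show "AE \<omega> in M k. \<omega> \<in> E K k \<longrightarrow> \<bar>Z k \<omega>\<bar> \<le> \<delta> \<longrightarrow>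
            \<bar>calibration_error_at (N k) (f k \<omega>) (Y k) p\<bar> \<le> \<epsilon>"
          using w_hat(3)[of k]
        proof eventually_elim
          case (elim \<omega>)
          interpret score_predictor "N k" "U k \<omega>" "Y k" "F k \<omega>" "G k \<omega>"
            by (rule predictor[OF elim])
          show ?case
          proof (intro impI)
            assume "\<omega> \<in> E K k" and "\<bar>Z k \<omega>\<bar> \<le> \<delta>"
            then have "\<bar>calibration_error_at (N k) (f k \<omega>) (Y k) p\<bar> \<le> \<epsilon> / 2 + \<eta>'"
              unfolding f_eq E_def using \<delta>(2) \<open>\<epsilon> > 0\<close>
              by (intro calibration_error_at_le[where K = K]) auto
            then show "\<bar>calibration_error_at (N k) (f k \<omega>) (Y k) p\<bar> \<le> \<epsilon>"
              by (simp add: \<eta>'_def)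
          qed
        qed
      qed
    qed
  next
    fix m \<epsilon>
    assume version: "\<forall>k. AE \<omega> in M k. cond_exp_version (N k) (f k \<omega>) (Y k) (m k \<omega>)" and "0 < (\<epsilon> :: real)"
    let ?D = "\<lambda>k \<omega>. measure (distr (N k) borel (f k \<omega>)) {p\<in>range \<sigma>. \<bar>p - m k \<omega> p\<bar> > \<epsilon>}"
    show "tendsto_0_in_prob M ?D"
    proof (rule tendsto_0_in_probI[OF prob Z Z_lim])
      fix \<epsilon>' \<eta> :: real assume "\<epsilon>' > 0" "0 < \<eta>" "\<eta> < 1"
      \<comment> \<open>The Markov-type bound is the sum of a gap and a tail, each at most
        \<open>e\<close>, and must come to at most \<open>\<epsilon> * \<epsilon>'\<close>.\<close>
      define e where "e = \<epsilon> * \<epsilon>' / 2"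
      have e: "e > 0" using \<open>\<epsilon> > 0\<close> \<open>\<epsilon>' > 0\<close> by (simp add: e_def)
      obtain K where K: "measure std_normal_distribution {z. \<bar>z\<bar> > K} \<le> e"
        using real_distribution.exists_tail_le[OF real_dist_normal_dist e] by blast
      obtain \<delta> where \<delta>: "\<delta> > 0"
        "\<And>k \<omega> u. \<bar>Z k \<omega>\<bar> \<le> \<delta> \<Longrightarrow> \<bar>u\<bar> \<le> K \<Longrightarrow> \<bar>G k \<omega> u - F k \<omega> u\<bar> \<le> e"
        using close[OF e, of K] by auto
      show "\<exists>\<delta>>0. \<exists>E. (\<forall>\<^sub>F k in sequentially. measure (M k) (E k) \<ge> 1 - \<eta>) \<and>
          (\<forall>k. AE \<omega> in M k. \<omega> \<in> E k \<longrightarrow> \<bar>Z k \<omega>\<bar> \<le> \<delta> \<longrightarrow> \<bar>?D k \<omega>\<bar> \<le> \<epsilon>')"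
      \<comment> \<open>The whole space serves as the good event: the tail of the score is the same
        standard normal tail at almost every \<open>\<omega>\<close>.\<close>
      proof (intro exI[of _ \<delta>] exI[of _ "\<lambda>k. space (M k)"] conjI allI)
        show "\<delta> > 0" by (rule \<delta>(1))
        show "\<forall>\<^sub>F k in sequentially. measure (M k) (space (M k)) \<ge> 1 - \<eta>"
          using \<open>0 < \<eta>\<close> by (simp add: prob_space.prob_space[OF prob])
        fix k
        show "AE \<omega> in M k. \<omega> \<in> space (M k) \<longrightarrow> \<bar>Z k \<omega>\<bar> \<le> \<delta> \<longrightarrow> \<bar>?D k \<omega>\<bar> \<le> \<epsilon>'"
          using w_hat(3)[of k] version[rule_format, of k]
        proof eventually_elim
          case (elim \<omega>)
          interpret score_predictor "N k" "U k \<omega>" "Y k" "F k \<omega>" "G k \<omega>"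
            by (rule predictor[OF elim(1)])
          show ?case
          proof (intro impI)
            assume "\<bar>Z k \<omega>\<bar> \<le> \<delta>"
            then have "\<epsilon> * ?D k \<omega> \<le> e + measure (N k) {x\<in>space (N k). \<bar>U k \<omega> x\<bar> > K}"
              using elim(2) \<delta>(2) e \<open>\<epsilon> > 0\<close> unfolding f_eq
              by (intro cond_exp_version_deviation_le) auto
            also have "measure (N k) {x\<in>space (N k). \<bar>U k \<omega> x\<bar> > K} =
                measure std_normal_distribution {z. \<bar>z\<bar> > K}"
              using measure_standardized_score[OF gauss elim(1), of "{z. \<bar>z\<bar> > K}"]
              by (simp add: U_def)
            finally have "\<epsilon> * ?D k \<omega> \<le> \<epsilon> * \<epsilon>'" using K by (simp add: e_def)
            then show "\<bar>?D k \<omega>\<bar> \<le> \<epsilon>'" using \<open>\<epsilon> > 0\<close> by simp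
          qed
        qed
      qed
    qed
  qed
qed

end
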